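(* Let $\mathcal{H}$ be a complex separable Hilbert space, let $A$ be a bounded and injective operator on $\mathcal{H}$, let $g\in\operatorname{ran}A$, and let $f\in\mathcal{H}$ be the solution to $Af=g$. Then the following hold. (i) If $\overline{\mathcal{K}(A,g)}\cap\big(A\,\mathcal{K}(A,g)^\perp\big)=\{0\}$, then $f\in\overline{\mathcal{K}(A,g)}$. (ii) Assume further that $A$ is invertible with everywhere defined, bounded inverse on $\mathcal{H}$. Then $f\in\overline{\mathcal{K}(A,g)}$ if and only if $\overline{\mathcal{K}(A,g)}\cap\big(A\,\mathcal{K}(A,g)^\perp\big)=\{0\}$.
   Context: Bounded operators on $\mathcal{H}$ are linear and everywhere defined. For a bounded operator $A$ on $\mathcal{H}$ and $g\in\mathcal{H}$, the Krylov subspace is $\mathcal{K}(A,g):=\operatorname{span}\{A^kg\mid k\in\mathbb{N}_0\}$ (finite linear combinations, $\mathbb{N}_0=\{0,1,2,\dots\}$), $\overline{\mathcal{K}(A,g)}$ is its closure in the norm of $\mathcal{H}$, and $\mathcal{K}(A,g)^\perp$ is its orthogonal complement. $A\,\mathcal{K}(A,g)^\perp$ denotes the image of $\mathcal{K}(A,g)^\perp$ under $A$. *)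

theory Defs
  imports "HOL-Analysis.Analysis"
begin

section \<open>Complex Hilbert spaces\<close>

class complex_vector = real_vector +
  fixes scaleC :: "complex \<Rightarrow> 'a \<Rightarrow> 'a" (infixr "*\<^sub>C" 75)
  assumes scaleC_add_right: "a *\<^sub>C (x + y) = a *\<^sub>C x + a *\<^sub>C y"
    and scaleC_add_left: "(a + b) *\<^sub>C x = a *\<^sub>C x + b *\<^sub>C x"
    and scaleC_scaleC: "a *\<^sub>C b *\<^sub>C x = (a * b) *\<^sub>C x"
    and scaleC_one: "1 *\<^sub>C x = x"
    and scaleR_scaleC: "r *\<^sub>R x = complex_of_real r *\<^sub>C x"

global_interpretation complex_vector:
  vector_space "scaleC :: complex \<Rightarrow> 'a \<Rightarrow> 'a::complex_vector"
  defines cspan = complex_vector.span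
  by unfold_locales (rule scaleC_add_right scaleC_add_left scaleC_scaleC scaleC_one)+

text \<open>
  The inner product is antilinear in the first argument and linear in the second. The norm,
  metric and topology are those of \<^class>\<open>real_normed_vector\<close>, tied to the inner product by the
  last axiom; the norm axioms inherited from that class add no restriction, as they follow from
  the others by the Cauchy-Schwarz inequality.
\<close>

class complex_inner = complex_vector + real_normed_vector +
  fixes cinner :: "'a \<Rightarrow> 'a \<Rightarrow> complex"
  assumes cinner_commute: "cinner x y = cnj (cinner y x)"
    and cinner_add_right: "cinner x (y + z) = cinner x y + cinner x z"
    and cinner_scaleC_right: "cinner x (a *\<^sub>C y) = a * cinner x y"
    and cinner_ge_zero: "0 \<le> Re (cinner x x)"
    and cinner_eq_zero_iff: "cinner x x = 0 \<longleftrightarrow> x = 0"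
    and norm_eq_sqrt_cinner: "norm x = sqrt (Re (cinner x x))"

class chilbert_space = complex_inner + complete_space

definition corthogonal_complement :: "'a::complex_inner set \<Rightarrow> 'a set" where
  "corthogonal_complement S = {x. \<forall>y\<in>S. cinner y x = 0}"

definition bounded_clinear :: "('a::complex_inner \<Rightarrow> 'b::complex_inner) \<Rightarrow> bool" where
  "bounded_clinear A \<longleftrightarrow>
    Vector_Spaces.linear scaleC scaleC A \<and> (\<exists>K. \<forall>x. norm (A x) \<le> K * norm x)"

section \<open>Krylov subspaces\<close>

definition krylov :: "('a::complex_inner \<Rightarrow> 'a) \<Rightarrow> 'a \<Rightarrow> 'a set" where
  "krylov A g = cspan {(A ^^ k) g | k. True}"

end

theory Submission
  imports Defs
begin

text \<open>
  Write \<open>K\<close> for the closure of the Krylov space. It is a closed subspace that is invariant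
  under \<open>A\<close> and contains \<open>g\<close>, and its only vector orthogonal to the Krylov space is \<open>0\<close>.

  For the first part, split \<open>f = p + q\<close> with \<open>p \<in> K\<close> and \<open>q \<bottom> K\<close>. Then \<open>A q = g - A p\<close> lies both
  in \<open>K\<close> and in the image of the orthogonal complement, so it vanishes; injectivity gives \<open>q = 0\<close>,
  that is, \<open>f = p \<in> K\<close>.

  For the converse with a bounded inverse \<open>B\<close>, the vectors \<open>B (A\<^sup>k g)\<close> are \<open>f, g, A g, \<dots>\<close>. If
  \<open>f \<in> K\<close>, they all lie in \<open>K\<close>, so \<open>K\<close> is invariant under \<open>B\<close> too. A vector \<open>A w \<in> K\<close> with \<open>w\<close>
  orthogonal to the Krylov space then satisfies \<open>w = B (A w) \<in> K\<close>, hence \<open>w = 0\<close>.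

  The analytic input is the orthogonal decomposition along a closed subspace
  (\<open>orthogonal_decomposition\<close>) and the fact that a bounded operator maps a closed span into any
  closed subspace that contains the images of the generators (\<open>bounded_clinear_closure_cspan\<close>).
\<close>

section \<open>Algebra of the inner product\<close>

lemma scaleC_minus_one: "(- 1) *\<^sub>C x = - (x::'a::complex_vector)"
  using scaleR_scaleC[of "-1" x] by simp

lemma cinner_add_left: "cinner (x + y) z = cinner x z + cinner y (z::'a::complex_inner)"
  by (metis cinner_add_right cinner_commute complex_cnj_add)

lemma cinner_scaleC_left: "cinner (a *\<^sub>C x) y = cnj a * cinner x (y::'a::complex_inner)"
  by (metis cinner_commute cinner_scaleC_right complex_cnj_mult)

lemma cinner_minus_right: "cinner x (- y) = - cinner x (y::'a::complex_inner)"
  using cinner_scaleC_right[of x "-1" y] by (simp add: scaleC_minus_one)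

lemma cinner_minus_left: "cinner (- x) y = - cinner x (y::'a::complex_inner)"
  using cinner_scaleC_left[of "-1" x y] by (simp add: scaleC_minus_one)

lemma cinner_zero_right: "cinner x (0::'a::complex_inner) = 0"
  using cinner_add_right[of x 0 0] by simp

lemma cinner_diff_right: "cinner x (y - z) = cinner x y - cinner x (z::'a::complex_inner)"
  using cinner_add_right[of x y "- z"] by (simp add: cinner_minus_right)

lemma cinner_diff_left: "cinner (x - y) z = cinner x z - cinner y (z::'a::complex_inner)"
  using cinner_add_left[of x "- y" z] by (simp add: cinner_minus_left)

lemma norm_square_cinner: "(norm x)\<^sup>2 = Re (cinner x (x::'a::complex_inner))"
  by (simp add: norm_eq_sqrt_cinner cinner_ge_zero)

lemma cinner_self: "cinner x x = complex_of_real ((norm (x::'a::complex_inner))\<^sup>2)"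
proof (rule complex_eqI)
  show "Im (cinner x x) = Im (complex_of_real ((norm x)\<^sup>2))"
    using arg_cong[OF cinner_commute[of x x], of Im] by simp
qed (simp add: norm_square_cinner)

lemma norm_scaleC: "norm (a *\<^sub>C x) = cmod a * norm (x::'a::complex_inner)"
proof (rule power2_eq_imp_eq)
  have "cinner (a *\<^sub>C x) (a *\<^sub>C x) = (a * cnj a) * cinner x x"
    by (simp add: cinner_scaleC_left cinner_scaleC_right)
  also have "\<dots> = complex_of_real ((cmod a * norm x)\<^sup>2)"
    by (simp add: cinner_self complex_norm_square[symmetric] power_mult_distrib)
  finally show "(norm (a *\<^sub>C x))\<^sup>2 = (cmod a * norm x)\<^sup>2"
    by (simp add: norm_square_cinner)
qed simp_all

lemma parallelogram:
  fixes x y :: "'a::complex_inner"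
  shows "(norm (x + y))\<^sup>2 + (norm (x - y))\<^sup>2 = 2 * (norm x)\<^sup>2 + 2 * (norm y)\<^sup>2"
  by (simp add: norm_square_cinner cinner_add_left cinner_add_right
      cinner_diff_left cinner_diff_right)

section \<open>Closed subspaces and bounded operators\<close>

lemma subspace_if_csubspace: "complex_vector.subspace S \<Longrightarrow> subspace S"
  unfolding complex_vector.subspace_def subspace_def by (simp add: scaleR_scaleC)

lemma continuous_on_scaleC: "continuous_on S (\<lambda>x. a *\<^sub>C (x::'a::complex_inner))"
proof -
  have "bounded_linear (\<lambda>x::'a. a *\<^sub>C x)"
    by (rule bounded_linear_intro[where K = "cmod a"])
      (simp_all add: scaleC_add_right scaleR_scaleC scaleC_scaleC norm_scaleC mult.commute)
  then show ?thesis
    by (rule linear_continuous_on)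
qed

lemma csubspace_closure:
  fixes S :: "'a::complex_inner set"
  assumes S: "complex_vector.subspace S"
  shows "complex_vector.subspace (closure S)"
proof -
  have "x + y \<in> closure S" if "x \<in> closure S" "y \<in> closure S" for x y
  proof -
    have "(\<lambda>z. fst z + snd z) ` (S \<times> S) \<subseteq> closure S"
      using S closure_subset unfolding complex_vector.subspace_def by force
    then have "(\<lambda>z. fst z + snd z) ` closure (S \<times> S) \<subseteq> closure S"
      by (intro image_closure_subset continuous_intros closed_closure)
    with that show ?thesis by (force simp: closure_Times)
  qed
  moreover have "a *\<^sub>C x \<in> closure S" if "x \<in> closure S" for a x
  proof -
    have "(\<lambda>x. a *\<^sub>C x) ` S \<subseteq> closure S"
      using S closure_subset unfolding complex_vector.subspace_def by blast
    then have "(\<lambda>x. a *\<^sub>C x) ` closure S \<subseteq> closure S"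
      by (intro image_closure_subset continuous_on_scaleC closed_closure)
    with that show ?thesis by blast
  qed
  moreover have "0 \<in> closure S"
    using S closure_subset unfolding complex_vector.subspace_def by blast
  ultimately show ?thesis
    unfolding complex_vector.subspace_def by blast
qed

lemma bounded_clinear_imp_bounded_linear:
  assumes T: "bounded_clinear T"
  shows "bounded_linear T"
proof -
  from T obtain K where lin: "Vector_Spaces.linear scaleC scaleC T"
    and K: "\<And>x. norm (T x) \<le> K * norm x"
    unfolding bounded_clinear_def by blast
  interpret Vector_Spaces.linear scaleC scaleC T by (rule lin)
  show ?thesis
    by (rule bounded_linear_intro[where K = K])
      (use K in \<open>simp_all add: add scale scaleR_scaleC mult.commute\<close>)
qed

text \<open>
  This gives the invariance of the closed Krylov space under the operator and, in the invertible
  case, under its inverse: only the images of the generators need to be checked.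
\<close>
lemma bounded_clinear_closure_cspan:
  assumes T: "bounded_clinear T"
    and S: "complex_vector.subspace S" "closed S"
    and G: "T ` G \<subseteq> S"
  shows "T ` closure (cspan G) \<subseteq> S"
proof (rule image_closure_subset)
  show "continuous_on (closure (cspan G)) T"
    by (intro linear_continuous_on bounded_clinear_imp_bounded_linear T)
  interpret Vector_Spaces.linear scaleC scaleC T
    using T by (simp add: bounded_clinear_def)
  have "T x \<in> S" if "x \<in> cspan G" for x
    using that
  proof (induction rule: complex_vector.span_induct)
    case base
    show ?case
      using S(1) by (simp add: complex_vector.subspace_def add scale zero)
  qed (use G in blast)
  then show "T ` cspan G \<subseteq> S" by blast
qed (rule S)

section \<open>Orthogonal decomposition\<close>

text \<open>
  The points of \<open>S\<close> whose distance to \<open>f\<close> exceeds the infimum by little form shrinking closed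
  sets: by the parallelogram law two such points are close to each other, because their midpoint
  lies in \<open>S\<close> and cannot be nearer to \<open>f\<close> than the infimum. Completeness gives a common point.
\<close>
lemma nearest_point_exists:
  fixes S :: "'a::chilbert_space set"
  assumes S: "complex_vector.subspace S" "closed S"
  obtains p where "p \<in> S" "\<And>y. y \<in> S \<Longrightarrow> norm (f - p) \<le> norm (f - y)"
proof -
  have sub: "subspace S" by (intro subspace_if_csubspace S)
  then have ne: "S \<noteq> {}" using subspace_0 by blast
  define d where "d = infdist f S"
  have d0: "0 \<le> d" by (simp add: d_def infdist_nonneg)
  have d_le: "d \<le> norm (f - y)" if "y \<in> S" for y
    using infdist_le[OF that, of f] by (simp add: d_def dist_norm)
  define C where "C n = S \<inter> cball f (d + inverse (Suc n))" for n
  have midpoint: "(norm (x - y))\<^sup>2 \<le> 8 * d * r + 4 * r\<^sup>2"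
    if x: "x \<in> S" "norm (f - x) \<le> d + r" and y: "y \<in> S" "norm (f - y) \<le> d + r" for x y r
  proof -
    let ?m = "(1/2) *\<^sub>R (x + y)"
    have "?m \<in> S" using sub x y by (simp add: subspace_add subspace_mul)
    then have "d\<^sup>2 \<le> (norm (f - ?m))\<^sup>2" by (intro power_mono d_le d0)
    moreover have "(f - x) + (f - y) = 2 *\<^sub>R (f - ?m)"
      by (simp add: algebra_simps scaleR_2)
    then have "(norm ((f - x) + (f - y)))\<^sup>2 = 4 * (norm (f - ?m))\<^sup>2"
      by (simp add: power_mult_distrib)
    moreover have "(norm ((f - x) - (f - y)))\<^sup>2 = (norm (x - y))\<^sup>2"
      by (simp add: norm_minus_commute)
    moreover have "(norm (f - x))\<^sup>2 \<le> (d + r)\<^sup>2" "(norm (f - y))\<^sup>2 \<le> (d + r)\<^sup>2"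
      using x y by (auto intro: power_mono)
    moreover have "4 * (d + r)\<^sup>2 - 4 * d\<^sup>2 = 8 * d * r + 4 * r\<^sup>2"
      by (simp add: power2_eq_square algebra_simps)
    ultimately show ?thesis
      using parallelogram[of "f - x" "f - y"] by linarith
  qed
  have "\<exists>p. \<forall>n. p \<in> C n"
  proof (rule decreasing_closed_nest)
    show "closed (C n)" for n
      using S by (auto simp: C_def)
    show "C n \<noteq> {}" for n
    proof -
      have "infdist f S < d + inverse (Suc n)" by (simp add: d_def)
      then obtain y where "y \<in> S" "dist f y < d + inverse (Suc n)"
        using ne cInf_lessD[of "dist f ` S"] by (auto simp: infdist_notempty)
      then show ?thesis by (auto simp: C_def)
    qed
    show "C n \<subseteq> C m" if "m \<le> n" for m n
      using that by (auto simp: C_def elim!: order_trans intro!: le_imp_inverse_le)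
    show "\<exists>n. \<forall>x\<in>C n. \<forall>y\<in>C n. dist x y < e" if "0 < e" for e
    proof -
      have "(\<lambda>n. 8 * d * inverse (real (Suc n)) + 4 * (inverse (real (Suc n)))\<^sup>2)
          \<longlonglongrightarrow> 8 * d * 0 + 4 * 0\<^sup>2"
        by (intro tendsto_intros LIMSEQ_inverse_real_of_nat)
      then have "eventually
          (\<lambda>n. 8 * d * inverse (real (Suc n)) + 4 * (inverse (real (Suc n)))\<^sup>2 < e\<^sup>2) sequentially"
        using that by (intro order_tendstoD) auto
      then obtain n where
        n: "8 * d * inverse (real (Suc n)) + 4 * (inverse (real (Suc n)))\<^sup>2 < e\<^sup>2"
        by (auto simp: eventually_sequentially)
      have "dist x y < e" if "x \<in> C n" "y \<in> C n" for x y
      proof -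
        have "(norm (x - y))\<^sup>2 < e\<^sup>2"
          using midpoint[of x "inverse (Suc n)" y] that n by (auto simp: C_def dist_norm)
        then show ?thesis
          using \<open>0 < e\<close> by (auto simp: dist_norm intro: power2_less_imp_less)
      qed
      then show ?thesis by blast
    qed
  qed blast
  then obtain p where p: "\<And>n. p \<in> C n" by blast
  have "norm (f - p) \<le> d"
  proof (rule LIMSEQ_le_const)
    show "(\<lambda>n. d + inverse (real (Suc n))) \<longlonglongrightarrow> d"
      using tendsto_add[OF tendsto_const LIMSEQ_inverse_real_of_nat] by simp
    show "\<exists>N. \<forall>n\<ge>N. norm (f - p) \<le> d + inverse (real (Suc n))"
      using p by (auto simp: C_def dist_norm)
  qed
  then show ?thesis
    using that[of p] p[of 0] d_le by (force simp: C_def)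
qed

text \<open>
  If \<open>f - p\<close> had a component along some \<open>y \<in> S\<close>, adding it to \<open>p\<close> would give a point of \<open>S\<close>
  nearer to \<open>f\<close>.
\<close>
lemma orthogonal_decomposition:
  fixes S :: "'a::chilbert_space set"
  assumes S: "complex_vector.subspace S" "closed S"
  obtains p q where "f = p + q" "p \<in> S" "q \<in> corthogonal_complement S"
proof -
  obtain p where p: "p \<in> S" and min: "\<And>y. y \<in> S \<Longrightarrow> norm (f - p) \<le> norm (f - y)"
    using nearest_point_exists[OF S] by blast
  define q where "q = f - p"
  have "cinner y q = 0" if y: "y \<in> S" for y
  proof (cases "y = 0")
    case True
    then show ?thesis using cinner_commute[of y q] by (simp add: cinner_zero_right)
  next
    case False
    define c where "c = cinner y q"
    define N where "N = (norm y)\<^sup>2"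
    have N: "N > 0" using False by (simp add: N_def)
    \<comment> \<open>\<open>a *\<^sub>C y\<close> is the orthogonal projection of \<open>q\<close> onto the line through \<open>y\<close>.\<close>
    define a where "a = c / complex_of_real N"
    have "p + a *\<^sub>C y \<in> S"
      using S(1) p y by (simp add: complex_vector.subspace_def)
    from min[OF this] have "norm q \<le> norm (q - a *\<^sub>C y)"
      by (simp add: q_def algebra_simps)
    then have le: "(norm q)\<^sup>2 \<le> (norm (q - a *\<^sub>C y))\<^sup>2" by (intro power_mono) auto
    have "cinner y q = c" "cinner q y = cnj c" "cinner y y = complex_of_real N"
      using cinner_commute[of q y] by (simp_all add: c_def N_def cinner_self)
    then have "cinner (q - a *\<^sub>C y) (q - a *\<^sub>C y)
        = cinner q q - a * cnj c - cnj a * c + cnj a * a * complex_of_real N"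
      by (simp add: cinner_diff_left cinner_diff_right cinner_scaleC_left cinner_scaleC_right
          algebra_simps)
    also have "\<dots> = cinner q q - c * cnj c / complex_of_real N"
      using N by (simp add: a_def field_simps)
    also have "\<dots> = cinner q q - complex_of_real ((cmod c)\<^sup>2 / N)"
      by (simp add: complex_norm_square[symmetric])
    finally have "(norm (q - a *\<^sub>C y))\<^sup>2 = (norm q)\<^sup>2 - (cmod c)\<^sup>2 / N"
      by (simp only: norm_square_cinner minus_complex.sel Re_complex_of_real)
    with le have "(cmod c)\<^sup>2 / N \<le> 0" by simp
    then show ?thesis using N by (simp add: divide_le_0_iff c_def)
  qed
  then have "q \<in> corthogonal_complement S"
    by (simp add: corthogonal_complement_def)
  then show ?thesis
    using that[of p q] p by (simp add: q_def)
qed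

text \<open>
  By Pythagoras every vector of \<open>S\<close> has distance at least \<open>norm w\<close> from a vector \<open>w\<close> orthogonal
  to \<open>S\<close>, whereas the closure allows arbitrarily small distances.
\<close>
lemma closure_orthogonal_eq_0:
  assumes w: "w \<in> closure S" "w \<in> corthogonal_complement S"
  shows "w = 0"
proof (rule ccontr)
  assume "w \<noteq> 0"
  then obtain y where y: "y \<in> S" "dist y w < norm w"
    using w(1) by (metis closure_approachable zero_less_norm_iff)
  have "cinner y w = 0" "cinner w y = 0"
    using w(2) y(1) cinner_commute[of w y] by (auto simp: corthogonal_complement_def)
  then have "(norm (y - w))\<^sup>2 = (norm y)\<^sup>2 + (norm w)\<^sup>2"
    by (simp add: norm_square_cinner cinner_diff_left cinner_diff_right)
  then have "(norm w)\<^sup>2 \<le> (norm (y - w))\<^sup>2" by simp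
  then have "norm w \<le> norm (y - w)" by (rule power2_le_imp_le) simp
  with y(2) show False by (simp add: dist_norm)
qed

lemma corthogonal_complement_antimono:
  "S \<subseteq> T \<Longrightarrow> corthogonal_complement T \<subseteq> corthogonal_complement S"
  by (auto simp: corthogonal_complement_def)

section \<open>Krylov solvability\<close>

lemma csubspace_krylov: "complex_vector.subspace (krylov A g)"
  by (simp add: krylov_def)

lemma power_in_krylov: "(A ^^ k) g \<in> krylov A g"
  unfolding krylov_def by (rule complex_vector.span_base) blast

lemma closure_krylov_invariant:
  assumes T: "bounded_clinear T"
    and G: "\<And>k. T ((A ^^ k) g) \<in> closure (krylov A g)"
  shows "T ` closure (krylov A g) \<subseteq> closure (krylov A g)"
  using bounded_clinear_closure_cspan[OF T csubspace_closure[OF csubspace_krylov] closed_closure,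
      of "{(A ^^ k) g | k. True}" A g] G
  by (auto simp: krylov_def)

theorem proposition3p4:
  fixes A :: "'h::chilbert_space \<Rightarrow> 'h" and f g :: 'h
  assumes separable: "separable_space (euclidean :: 'h topology)"
    and bounded: "bounded_clinear A"
    and injective: "inj A"
    and g_in_range: "g \<in> range A"
    and solution: "A f = g"
  shows "(closure (krylov A g) \<inter> A ` corthogonal_complement (krylov A g) = {0}
            \<longrightarrow> f \<in> closure (krylov A g))
       \<and> ((\<exists>B. bounded_clinear B \<and> B \<circ> A = id \<and> A \<circ> B = id)
            \<longrightarrow> (f \<in> closure (krylov A g) \<longleftrightarrow>
                 closure (krylov A g) \<inter> A ` corthogonal_complement (krylov A g) = {0}))"
proof -
  let ?K = "closure (krylov A g)" and ?P = "corthogonal_complement (krylov A g)"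
  interpret A: bounded_linear A
    by (rule bounded_clinear_imp_bounded_linear[OF bounded])
  have csub: "complex_vector.subspace ?K"
    by (intro csubspace_closure csubspace_krylov)
  then have sub: "subspace ?K" by (rule subspace_if_csubspace)
  have pow: "(A ^^ k) g \<in> ?K" for k
    using power_in_krylov closure_subset by blast
  have A_inv: "A ` ?K \<subseteq> ?K"
    using closure_krylov_invariant[OF bounded] pow[of "Suc _"] by simp
  have first: "f \<in> ?K" if triv: "?K \<inter> A ` ?P = {0}"
  proof -
    obtain p q where f: "f = p + q" and p: "p \<in> ?K" and q: "q \<in> corthogonal_complement ?K"
      using orthogonal_decomposition[OF csub closed_closure] by blast
    have "A q = g - A p" using solution by (simp add: f A.add algebra_simps)
    moreover have "g - A p \<in> ?K"
      using subspace_diff[OF sub] pow[of 0] A_inv p by auto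
    moreover have "q \<in> ?P"
      using q corthogonal_complement_antimono[OF closure_subset] by blast
    ultimately have "A q \<in> ?K \<inter> A ` ?P" by (metis IntI imageI)
    then have "A q = 0" by (simp only: triv singleton_iff)
    then have "q = 0" using injective A.zero by (metis injD)
    with f p show ?thesis by simp
  qed
  have second: "?K \<inter> A ` ?P = {0}"
    if B: "bounded_clinear B" "B \<circ> A = id" and f: "f \<in> ?K" for B
  proof -
    have BA: "B (A x) = x" for x
      using B(2) by (metis comp_apply id_apply)
    have "B ((A ^^ k) g) \<in> ?K" for k
    proof (cases k)
      case 0
      then show ?thesis using f BA[of f] solution by simp
    next
      case (Suc m)
      then show ?thesis using pow[of m] by (simp add: BA)
    qed
    then have B_inv: "B ` ?K \<subseteq> ?K"
      by (rule closure_krylov_invariant[OF B(1)])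
    have "A w = 0" if "w \<in> ?P" "A w \<in> ?K" for w
    proof -
      have "w \<in> ?K" using B_inv that(2) BA[of w] by force
      then have "w = 0" using that(1) by (rule closure_orthogonal_eq_0)
      then show ?thesis by (simp add: A.zero)
    qed
    moreover have "0 \<in> ?P"
      by (simp add: corthogonal_complement_def cinner_zero_right)
    then have "0 \<in> A ` ?P" by (metis A.zero imageI)
    ultimately show ?thesis using subspace_0[OF sub] by auto
  qed
  from first second show ?thesis by blast
qed

end
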